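(* Let $\mathcal{A}$ be a rank $d$ central arrangement of $n$ weighted, cooriented hyperplanes defined by nonzero integer vectors $a_1,\dots,a_n\in\mathfrak{t}^d\cong\mathbb{Z}^d$. Then $$h_{\mathcal{A}}(q)=\sum_{F\in L(\mathcal{A})}h^{br}_{\mathcal{A}^F}(q)\cdot h_{\operatorname{rk}F}(\mathcal{A}_F)\,q^{\operatorname{rk}F}.$$
   Context: Let $a_1,\dots,a_n\in\mathfrak{t}^d\cong\mathbb{Z}^d$ be nonzero vectors spanning a sublattice of rank $d$. The central arrangement $\mathcal{A}$ consists of the hyperplanes $H_i=\{v\in(\mathfrak{t}^d)^*\mid v\cdot a_i=0\}$ with normal vectors $a_i$ (repetitions allowed). For $S\subseteq\{1,\dots,n\}$ let $H_S=\bigcap_{i\in S}H_i$. A flat is a subset $F$ with $F=\{i\mid H_i\supseteq H_F\}$; $L(\mathcal{A})$ is the lattice of flats. The restriction $\mathcal{A}^F=\{H_i\cap H_F\mid i\notin F\}$ is an arrangement of $|F^c|$ hyperplanes (with multiplicity) in $H_F$, and the localization $\mathcal{A}_F=\{H_i/H_F\mid i\in F\}$ is an arrangement of $|F|$ hyperplanes in $(\mathfrak{t}^d)^*/H_F$. The rank of a central arrangement is the rank of the span of its normal vectors, and $\operatorname{rk}F=\operatorname{rk}\mathcal{A}_F$. For a central arrangement $\mathcal{B}$ of rank $\rho$ with nonzero normal vectors $b_j$, $j\in E$: the matroid complex $\Delta_{\mathcal{B}}$ is the complex of $S\subseteq E$ with $\{b_j\mid j\in S\}$ linearly independent (as a family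 indexed by $S$). A circuit is a minimal dependent set; given an ordering $\sigma$ of $E$, a $\sigma$-broken circuit is $C\smallsetminus\{i\}$ with $C$ a circuit and $i$ its $\sigma$-minimal element; $\operatorname{bc}_\sigma\Delta_{\mathcal{B}}$ is the complex of subsets of $E$ containing no $\sigma$-broken circuit. Both complexes have dimension $\rho-1$. The $h$-numbers of a complex with $f_i$ faces of cardinality $i$ and dimension $\rho-1$ are defined by $\sum_{i=0}^{\rho}h_iq^i=\sum_{i=0}^{\rho}f_iq^i(1-q)^{\rho-i}$. Write $h_{\mathcal{B}}(q)$ for the $h$-polynomial of $\Delta_{\mathcal{B}}$, $h_i(\mathcal{B})$ for the coefficient of $q^i$ in it, and $h^{br}_{\mathcal{B}}(q)$ for the $h$-polynomial of $\operatorname{bc}_\sigma\Delta_{\mathcal{B}}$ (independent of $\sigma$). *)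

theory Defs
  imports
    Complex_Main
    "HOL-Computational_Algebra.Polynomial"
    "HOL-Library.Function_Algebras"
    "Jordan_Normal_Form.Matrix"
begin

text \<open>Real-valued functions form a real vector space; the dual of a space of vectors is
  viewed inside it, a functional being extended by 0 outside the space.\<close>

definition fun_scale :: "real \<Rightarrow> ('v \<Rightarrow> real) \<Rightarrow> ('v \<Rightarrow> real)"
  where "fun_scale c f = (\<lambda>v. c * f v)"

interpretation funs: vector_space fun_scale
  by unfold_locales (auto simp: fun_scale_def fun_eq_iff algebra_simps)

text \<open>A central arrangement is recorded by its index set, its ambient space and its normal vectors.
  The normal vector \<open>normal \<B> i\<close> is a functional on the ambient space, equal to 0 outside it.
  The coorientation and the weight of a hyperplane consist of the choice of the normal vector
  itself, as opposed to the hyperplane it defines.\<close>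

record ('i, 'v) arrangement =
  indices :: "'i set"
  ambient :: "'v set"
  normal :: "'i \<Rightarrow> 'v \<Rightarrow> real"

definition hyperplane :: "('i, 'v) arrangement \<Rightarrow> 'i \<Rightarrow> 'v set"
  where "hyperplane \<B> i = {v \<in> ambient \<B>. normal \<B> i v = 0}"

definition hyperplane_Int :: "('i, 'v) arrangement \<Rightarrow> 'i set \<Rightarrow> 'v set"
  where "hyperplane_Int \<B> S = ambient \<B> \<inter> (\<Inter>i\<in>S. hyperplane \<B> i)"

definition flats :: "('i, 'v) arrangement \<Rightarrow> 'i set set"
  where "flats \<B> = {F. F \<subseteq> indices \<B> \<and>
           F = {i \<in> indices \<B>. hyperplane_Int \<B> F \<subseteq> hyperplane \<B> i}}"

definition arr_rank :: "('i, 'v) arrangement \<Rightarrow> nat"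
  where "arr_rank \<B> = funs.dim (funs.span (normal \<B> ` indices \<B>))"

definition restriction :: "('i, 'v) arrangement \<Rightarrow> 'i set \<Rightarrow> ('i, 'v) arrangement"
  where "restriction \<B> F =
    \<lparr> indices = indices \<B> - F,
      ambient = hyperplane_Int \<B> F,
      normal = (\<lambda>i v. if v \<in> hyperplane_Int \<B> F then normal \<B> i v else 0) \<rparr>"

definition cosets :: "'v::plus set \<Rightarrow> 'v set \<Rightarrow> 'v set set"
  where "cosets V W = (\<lambda>v. (\<lambda>w. v + w) ` W) ` V"

text \<open>For \<open>i \<in> F\<close> the functional \<open>normal \<B> i\<close> vanishes on \<open>hyperplane_Int \<B> F\<close>, so it is constant
  on each coset; that constant is the value of the induced functional on the quotient.\<close>

definition localization :: "('i, 'v::plus) arrangement \<Rightarrow> 'i set \<Rightarrow> ('i, 'v set) arrangement"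
  where "localization \<B> F =
    (let Q = cosets (ambient \<B>) (hyperplane_Int \<B> F) in
     \<lparr> indices = F,
       ambient = Q,
       normal = (\<lambda>i X. if X \<in> Q then the_elem (normal \<B> i ` X) else 0) \<rparr>)"

definition flat_rank :: "('i, 'v::plus) arrangement \<Rightarrow> 'i set \<Rightarrow> nat"
  where "flat_rank \<B> F = arr_rank (localization \<B> F)"

definition matroid_complex :: "('i, 'v) arrangement \<Rightarrow> 'i set set"
  where "matroid_complex \<B> = {S. S \<subseteq> indices \<B> \<and>
           inj_on (normal \<B>) S \<and> funs.independent (normal \<B> ` S)}"

definition circuits :: "('i, 'v) arrangement \<Rightarrow> 'i set set"
  where "circuits \<B> = {C. C \<subseteq> indices \<B> \<and> C \<notin> matroid_complex \<B> \<and>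
           (\<forall>D. D \<subset> C \<longrightarrow> D \<in> matroid_complex \<B>)}"

text \<open>An ordering \<open>\<sigma>\<close> is given by its reflexive relation: \<open>(i, j) \<in> \<sigma>\<close> means that \<open>i\<close> is at most
  \<open>j\<close>.\<close>

definition broken_circuits :: "('i, 'v) arrangement \<Rightarrow> 'i rel \<Rightarrow> 'i set set"
  where "broken_circuits \<B> \<sigma> =
    {C - {i} | C i. C \<in> circuits \<B> \<and> i \<in> C \<and> (\<forall>j\<in>C. (i, j) \<in> \<sigma>)}"

definition bc_complex :: "('i, 'v) arrangement \<Rightarrow> 'i rel \<Rightarrow> 'i set set"
  where "bc_complex \<B> \<sigma> = {S. S \<subseteq> indices \<B> \<and> (\<forall>B \<in> broken_circuits \<B> \<sigma>. \<not> B \<subseteq> S)}"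

text \<open>The maximal cardinality \<open>\<rho>\<close> of a face is the dimension of the complex plus one.\<close>

definition h_polynomial :: "'i set set \<Rightarrow> int poly"
  where "h_polynomial \<Delta> =
    (let \<rho> = Max (card ` \<Delta>) in
     \<Sum>i\<le>\<rho>. of_nat (card {S \<in> \<Delta>. card S = i}) * [:0, 1:] ^ i * [:1, - 1:] ^ (\<rho> - i))"

definition h_arr :: "('i, 'v) arrangement \<Rightarrow> int poly"
  where "h_arr \<B> = h_polynomial (matroid_complex \<B>)"

definition h_br :: "('i, 'v) arrangement \<Rightarrow> 'i rel \<Rightarrow> int poly"
  where "h_br \<B> \<sigma> = h_polynomial (bc_complex \<B> \<sigma>)"

text \<open>The arrangement in the real vector space dual to \<open>\<int>\<^sup>d\<close>, with normal vectors
  \<open>a 1, \<dots>, a n\<close>, which act on it by \<open>v \<mapsto> v \<bullet> a i\<close>.\<close>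

definition integer_arrangement :: "nat \<Rightarrow> nat \<Rightarrow> (nat \<Rightarrow> int vec) \<Rightarrow> (nat, real vec) arrangement"
  where "integer_arrangement d n a =
    \<lparr> indices = {1..n},
      ambient = carrier_vec d,
      normal = (\<lambda>i v. if v \<in> carrier_vec d then v \<bullet> map_vec real_of_int (a i) else 0) \<rparr>"

end

theory Submission imports Defs begin

text \<open>Both sides are sums over flats \<open>G\<close> of integers times \<open>q\<^sup>k (1 - q)\<^sup>d\<^sup>-\<^sup>k\<close>, where \<open>k\<close> is the rank
  of \<open>G\<close>, and up to a common sign the integers are as follows.
  Let \<open>i(F)\<close> be the sum of \<open>(-1)\<^sup>|\<^sup>S\<^sup>|\<close> over the independent \<open>S \<subseteq> F\<close>, let
  \<open>j(G)\<close> be the same sum over the independent \<open>S\<close> with closure \<open>G\<close>, and let \<open>b(F, G)\<close> be the sum over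
  the faces \<open>S\<close> of the broken circuit complex of the restriction to \<open>F\<close> such that \<open>F \<union> S\<close> has
  closure \<open>G\<close>. The claim is that \<open>\<Sum>\<^sub>F i(F) b(F, G) = j(G)\<close>. Whitney's broken circuit theorem says that
  \<open>b\<close> is the Moebius function of the lattice of flats, that is, \<open>\<Sum>\<^sub>G\<^sub>\<subseteq>\<^sub>H b(F, G)\<close> is \<open>1\<close> if \<open>F = H\<close> and
  \<open>0\<close> otherwise, and \<open>i(H) = \<Sum>\<^sub>G\<^sub>\<subseteq>\<^sub>H j(G)\<close>; hence the claim is Moebius inversion.\<close>

section \<open>Independence modulo a span\<close>

lemma sum_fun_apply: "(\<Sum>i\<in>A. f i) x = (\<Sum>i\<in>A. f i x :: real)"
  by (induction A rule: infinite_finite_induct) auto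

text \<open>Peels off one vector of \<open>S\<close> at a time with
  \<open>funs.span_breakdown_eq\<close>, so that span membership becomes a statement about
  coefficients, the form in which \<open>indep_over\<close> is phrased.\<close>

lemma span_image_Un:
  assumes "finite S"
  shows "x \<in> funs.span (N ` (F \<union> S)) \<longleftrightarrow>
    (\<exists>c. x - (\<Sum>i\<in>S. fun_scale (c i) (N i)) \<in> funs.span (N ` F))"
  using assms
proof (induction S arbitrary: x rule: finite_induct)
  case (insert i S)
  have "x \<in> funs.span (N ` (F \<union> insert i S)) \<longleftrightarrow>
    (\<exists>k. x - fun_scale k (N i) \<in> funs.span (N ` (F \<union> S)))"
    by (simp add: funs.span_breakdown_eq)
  also have "\<dots> \<longleftrightarrow> (\<exists>k c. x - fun_scale k (N i) - (\<Sum>i\<in>S. fun_scale (c i) (N i)) \<in> funs.span (N ` F))"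
    by (simp only: insert.IH)
  also have "\<dots> \<longleftrightarrow> (\<exists>c. x - (\<Sum>i\<in>insert i S. fun_scale (c i) (N i)) \<in> funs.span (N ` F))"
  proof safe
    fix k c assume *: "x - fun_scale k (N i) - (\<Sum>i\<in>S. fun_scale (c i) (N i)) \<in> funs.span (N ` F)"
    have "(\<Sum>j\<in>insert i S. fun_scale ((c(i := k)) j) (N j)) =
        fun_scale k (N i) + (\<Sum>j\<in>S. fun_scale ((c(i := k)) j) (N j))"
      using insert.hyps by simp
    also have "(\<Sum>j\<in>S. fun_scale ((c(i := k)) j) (N j)) = (\<Sum>j\<in>S. fun_scale (c j) (N j))"
      using insert.hyps by (intro sum.cong) auto
    finally show "\<exists>c. x - (\<Sum>i\<in>insert i S. fun_scale (c i) (N i)) \<in> funs.span (N ` F)"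
      using * unfolding diff_diff_eq by metis
  next
    fix c assume "x - (\<Sum>i\<in>insert i S. fun_scale (c i) (N i)) \<in> funs.span (N ` F)"
    then show "\<exists>k c. x - fun_scale k (N i) - (\<Sum>i\<in>S. fun_scale (c i) (N i)) \<in> funs.span (N ` F)"
      using insert.hyps by (intro exI[of _ "c i"] exI[of _ c]) (simp add: diff_diff_eq)
  qed
  finally show ?case .
qed simp

definition indep_over :: "('i \<Rightarrow> 'v \<Rightarrow> real) \<Rightarrow> 'i set \<Rightarrow> 'i set \<Rightarrow> bool"
  where "indep_over N F S \<longleftrightarrow>
    (\<forall>c. (\<Sum>i\<in>S. fun_scale (c i) (N i)) \<in> funs.span (N ` F) \<longrightarrow> (\<forall>i\<in>S. c i = 0))"

lemma indep_over_empty [simp]: "indep_over N F {}"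
  by (simp add: indep_over_def)

text \<open>A relation whose coefficient at \<open>i\<close> is nonzero can be solved for
  \<open>N i\<close>; one without \<open>i\<close> is a relation on \<open>S\<close>. This drives
  all later inductions.\<close>

lemma indep_over_insert:
  assumes "finite S" "i \<notin> S"
  shows "indep_over N F (insert i S) \<longleftrightarrow>
    indep_over N F S \<and> N i \<notin> funs.span (N ` (F \<union> S))"
proof safe
  assume ind: "indep_over N F (insert i S)"
  have upd: "(\<Sum>j\<in>insert i S. fun_scale ((c(i := k)) j) (N j)) =
      fun_scale k (N i) + (\<Sum>j\<in>S. fun_scale (c j) (N j))" for c k
  proof -
    have "(\<Sum>j\<in>S. fun_scale ((c(i := k)) j) (N j)) = (\<Sum>j\<in>S. fun_scale (c j) (N j))"
      using assms by (intro sum.cong) auto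
    then show ?thesis using assms by simp
  qed
  show "indep_over N F S"
    unfolding indep_over_def
  proof (intro allI impI ballI)
    fix c j assume *: "(\<Sum>i\<in>S. fun_scale (c i) (N i)) \<in> funs.span (N ` F)" and "j \<in> S"
    have "\<forall>j\<in>insert i S. (c(i := 0)) j = 0"
      using ind * upd[of c 0] unfolding indep_over_def by (metis add_0 funs.scale_zero_left)
    then show "c j = 0" using \<open>j \<in> S\<close> assms by (metis fun_upd_other insertI2)
  qed
  assume "N i \<in> funs.span (N ` (F \<union> S))"
  then obtain c where c: "N i - (\<Sum>i\<in>S. fun_scale (c i) (N i)) \<in> funs.span (N ` F)"
    using span_image_Un[OF assms(1)] by blast
  \<comment> \<open>The expression of \<open>N i\<close> modulo \<open>F\<close> is read as a
    relation with coefficient 1 at \<open>i\<close>.\<close>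
  have "(\<Sum>j\<in>insert i S. fun_scale (((\<lambda>j. - c j)(i := 1)) j) (N j)) =
      N i - (\<Sum>j\<in>S. fun_scale (c j) (N j))"
    unfolding upd by (simp add: sum_negf)
  then have "((\<lambda>j. - c j)(i := 1)) i = 0"
    using ind c unfolding indep_over_def by (metis insertI1)
  then show False by simp
next
  assume ind: "indep_over N F S" and i: "N i \<notin> funs.span (N ` (F \<union> S))"
  show "indep_over N F (insert i S)"
    unfolding indep_over_def
  proof (intro allI impI)
    fix c assume "(\<Sum>j\<in>insert i S. fun_scale (c j) (N j)) \<in> funs.span (N ` F)"
    then have *: "fun_scale (c i) (N i) + (\<Sum>j\<in>S. fun_scale (c j) (N j)) \<in> funs.span (N ` F)"
      using assms by simp
    have "c i = 0"
    proof (rule ccontr)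
      assume "c i \<noteq> 0"
      have "N i - (\<Sum>j\<in>S. fun_scale (- c j / c i) (N j)) =
          fun_scale (1 / c i) (fun_scale (c i) (N i) + (\<Sum>j\<in>S. fun_scale (c j) (N j)))"
        using \<open>c i \<noteq> 0\<close>
        by (simp add: funs.scale_right_distrib funs.scale_sum_right sum_negf)
      then have "N i - (\<Sum>j\<in>S. fun_scale (- c j / c i) (N j)) \<in> funs.span (N ` F)"
        using * by (simp add: funs.span_scale)
      then show False
        using i unfolding span_image_Un[OF assms(1)]
        by (auto dest: spec[of _ "\<lambda>j. - c j / c i"])
    qed
    then show "\<forall>j\<in>insert i S. c j = 0"
      using * ind unfolding indep_over_def by simp
  qed
qed

text \<open>Connects with the form used in \<open>matroid_complex\<close>: a repeated vector lies in
  the span of the earlier ones, so it breaks \<open>indep_over\<close> just as it breaks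
  injectivity.\<close>

lemma indep_over_empty_iff:
  assumes "finite S"
  shows "indep_over N {} S \<longleftrightarrow> inj_on N S \<and> funs.independent (N ` S)"
  using assms
proof (induction S rule: finite_induct)
  case (insert i S)
  show ?case
    unfolding indep_over_insert[OF insert.hyps] insert.IH
    using insert.hyps funs.independent_insert[of "N i" "N ` S"]
      funs.span_base[of "N i" "N ` S"]
    by (auto simp: inj_on_insert)
qed (simp add: funs.independent_empty)

section \<open>Dimension counts and minima of finite sets\<close>

lemma dim_insert_notin_span:
  assumes "finite W" "v \<notin> funs.span W"
  shows "funs.dim (insert v W) = Suc (funs.dim W)"
proof -
  obtain B where B: "B \<subseteq> W" "funs.independent B" "W \<subseteq> funs.span B" "card B = funs.dim W"
    using funs.basis_exists by blast
  then have sp: "funs.span B = funs.span W"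
    by (meson funs.span_mono funs.span_minimal funs.subspace_span subset_antisym)
  with assms have v: "v \<notin> funs.span B" by simp
  then have "v \<notin> B" by (auto dest: funs.span_base)
  have "funs.dim (insert v W) = card (insert v B)"
  proof (rule funs.dim_unique[of "insert v B"])
    show "insert v W \<subseteq> funs.span (insert v B)"
      using B(3) funs.span_mono[of B "insert v B"] funs.span_base[of v "insert v B"] by blast
    show "funs.independent (insert v B)"
      using v B(2) by (rule funs.independent_insertI)
  qed (use B in auto)
  then show ?thesis
    using \<open>v \<notin> B\<close> B finite_subset[OF B(1) assms(1)] by simp
qed

lemma dim_Un_indep_over:
  assumes "finite F" "finite S" "indep_over N F S"
  shows "funs.dim (N ` (F \<union> S)) = funs.dim (N ` F) + card S"
  using assms(2,3)
proof (induction S rule: finite_induct)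
  case (insert i S)
  then show ?case
    using dim_insert_notin_span[of "N ` (F \<union> S)" "N i"] assms(1)
    by (simp add: indep_over_insert)
qed simp

lemma dim_indep_over_empty:
  assumes "finite S" "indep_over N {} S"
  shows "funs.dim (N ` S) = card S"
  using dim_Un_indep_over[OF _ assms] funs.dim_eq_card_independent[of "{}"]
  by (simp add: funs.independent_empty)

lemma dim_mono_finite:
  assumes "finite W" "V \<subseteq> funs.span W"
  shows "funs.dim V \<le> funs.dim W"
proof -
  obtain B where B: "B \<subseteq> W" "funs.independent B" "W \<subseteq> funs.span B" "card B = funs.dim W"
    using funs.basis_exists by blast
  then have "V \<subseteq> funs.span B"
    using assms(2) by (meson funs.span_minimal funs.subspace_span subset_trans)
  then show ?thesis
    using funs.dim_le_card[of V B] B finite_subset[OF B(1) assms(1)] by simp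
qed

text \<open>Greedy selection: an element is kept exactly when it is not yet spanned.\<close>

lemma ex_indep_over_spanning:
  assumes "finite E"
  shows "\<exists>S\<subseteq>E. indep_over N F S \<and> N ` E \<subseteq> funs.span (N ` (F \<union> S))"
  using assms
proof (induction E rule: finite_induct)
  case (insert i E)
  then obtain S where S: "S \<subseteq> E" "indep_over N F S" "N ` E \<subseteq> funs.span (N ` (F \<union> S))"
    by blast
  show ?case
  proof (cases "N i \<in> funs.span (N ` (F \<union> S))")
    case True
    with S show ?thesis by (intro exI[of _ S]) auto
  next
    case False
    have "funs.span (N ` (F \<union> S)) \<subseteq> funs.span (N ` (F \<union> insert i S))"
      by (intro funs.span_mono) auto
    moreover have "indep_over N F (insert i S)"
      using False S insert.hyps finite_subset[OF S(1)] by (subst indep_over_insert) auto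
    ultimately show ?thesis
      using S funs.span_base[of "N i" "N ` (F \<union> insert i S)"]
      by (intro exI[of _ "insert i S"]) auto
  qed
qed auto

lemma linear_order_on_finite_min:
  assumes "linear_order_on X r" "finite A" "A \<noteq> {}" "A \<subseteq> X"
  obtains m where "m \<in> A" "\<forall>j\<in>A. (m, j) \<in> r"
proof -
  have "\<exists>m\<in>A. \<forall>j\<in>A. (m, j) \<in> r"
    using assms(2-4)
  proof (induction A rule: finite_ne_induct)
    case (singleton x)
    then show ?case using assms(1) by (auto simp: order_on_defs refl_on_def)
  next
    case (insert x A)
    then obtain m where m: "m \<in> A" "\<forall>j\<in>A. (m, j) \<in> r" by auto
    have r: "refl_on X r" "trans r" "total_on X r"
      using assms(1) by (auto simp: order_on_defs)
    have "(x, m) \<in> r \<or> (m, x) \<in> r"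
      using r m insert.prems by (metis insert_subset refl_on_def subsetD total_on_def)
    then show ?case
    proof
      assume "(x, m) \<in> r"
      then have "\<forall>j\<in>insert x A. (x, j) \<in> r"
        using m r insert.prems by (auto simp: refl_on_def dest: transD)
      then show ?thesis by blast
    next
      assume "(m, x) \<in> r"
      then show ?thesis using m by blast
    qed
  qed
  then show ?thesis using that by blast
qed

section \<open>Broken circuits and the lattice of flats\<close>

locale vector_family =
  fixes E :: "'i set" and N :: "'i \<Rightarrow> 'v \<Rightarrow> real"
  assumes finite_E: "finite E"
begin

definition cl :: "'i set \<Rightarrow> 'i set"
  where "cl X = {i \<in> E. N i \<in> funs.span (N ` X)}"

definition flat_sets :: "'i set set"
  where "flat_sets = {F. F \<subseteq> E \<and> cl F = F}"

definition rk :: "'i set \<Rightarrow> nat"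
  where "rk X = funs.dim (N ` X)"

text \<open>Independent sets of the matroid contraction by \<open>F\<close>. They turn out to be the
  faces of the matroid complex of the restriction; \<open>contraction {}\<close> belongs to the
  arrangement itself.\<close>

definition contraction :: "'i set \<Rightarrow> 'i set set"
  where "contraction F = {S. S \<subseteq> E - F \<and> indep_over N F S}"

definition contraction_circuits :: "'i set \<Rightarrow> 'i set set"
  where "contraction_circuits F =
    {C. C \<subseteq> E - F \<and> C \<notin> contraction F \<and> (\<forall>D. D \<subset> C \<longrightarrow> D \<in> contraction F)}"

definition nbc :: "'i set \<Rightarrow> 'i rel \<Rightarrow> 'i set set"
  where "nbc F r = {S. S \<subseteq> E - F \<and>
    (\<forall>C\<in>contraction_circuits F. \<forall>i\<in>C. (\<forall>j\<in>C. (i, j) \<in> r) \<longrightarrow> \<not> C - {i} \<subseteq> S)}"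

section \<open>Closure, flats and rank\<close>

lemma subset_cl: "X \<subseteq> E \<Longrightarrow> X \<subseteq> cl X"
  by (auto simp: cl_def intro: funs.span_base)

lemma cl_subset: "cl X \<subseteq> E"
  by (auto simp: cl_def)

lemma cl_mono: "X \<subseteq> Y \<Longrightarrow> cl X \<subseteq> cl Y"
  using funs.span_mono[of "N ` X" "N ` Y"] by (auto simp: cl_def)

lemma span_cl:
  assumes "X \<subseteq> E"
  shows "funs.span (N ` cl X) = funs.span (N ` X)"
proof
  have "N ` cl X \<subseteq> funs.span (N ` X)" by (auto simp: cl_def)
  then show "funs.span (N ` cl X) \<subseteq> funs.span (N ` X)"
    by (simp add: funs.span_minimal)
  show "funs.span (N ` X) \<subseteq> funs.span (N ` cl X)"
    using subset_cl[OF assms] by (intro funs.span_mono image_mono)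
qed

lemma cl_in_flat_sets: "X \<subseteq> E \<Longrightarrow> cl X \<in> flat_sets"
  using span_cl[of X] cl_subset[of X] by (simp add: flat_sets_def cl_def)

lemma rk_cl: "X \<subseteq> E \<Longrightarrow> rk (cl X) = rk X"
  unfolding rk_def using span_cl[of X] by (rule funs.span_eq_dim)

lemma flat_sets_subset: "F \<in> flat_sets \<Longrightarrow> F \<subseteq> E"
  by (simp add: flat_sets_def)

lemma finite_flat_sets [simp]: "finite flat_sets"
  using finite_E by (auto simp: flat_sets_def)

text \<open>Lets sums over the flats below \<open>H\<close>, grouped by closure, be read as sums
  over the sets inside \<open>H\<close>.\<close>

lemma cl_subset_flat_iff:
  assumes "H \<in> flat_sets" "X \<subseteq> E"
  shows "cl X \<subseteq> H \<longleftrightarrow> X \<subseteq> H"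
  using assms cl_mono[of X H] subset_cl[of X] by (auto simp: flat_sets_def)

lemma finite_contraction [simp]: "finite (contraction F)"
  using finite_E by (auto simp: contraction_def)

lemma finite_nbc [simp]: "finite (nbc F r)"
  using finite_E by (auto simp: nbc_def)

lemma rk_mono: "X \<subseteq> Y \<Longrightarrow> Y \<subseteq> E \<Longrightarrow> rk X \<le> rk Y"
  unfolding rk_def using finite_subset[OF _ finite_E]
  by (intro dim_mono_finite) (auto intro: funs.span_base)

lemma rk_Un_contraction:
  assumes "F \<subseteq> E" "S \<in> contraction F"
  shows "rk (F \<union> S) = rk F + card S"
  unfolding rk_def using assms finite_E
  by (intro dim_Un_indep_over) (auto simp: contraction_def intro: finite_subset)

lemma rk_eq_card: "S \<in> contraction {} \<Longrightarrow> rk S = card S"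
  unfolding rk_def contraction_def using finite_subset[OF _ finite_E]
  by (auto intro!: dim_indep_over_empty)

section \<open>Circuits of a contraction\<close>

lemma finite_circuit: "C \<in> contraction_circuits F \<Longrightarrow> finite C"
  using finite_subset[OF _ finite_E] by (auto simp: contraction_circuits_def)

text \<open>By minimality \<open>C - {i}\<close> is independent over \<open>F\<close>; were
  \<open>N i\<close> outside the span, adding \<open>i\<close> would keep it independent.\<close>

lemma circuit_span:
  assumes "C \<in> contraction_circuits F" "i \<in> C"
  shows "N i \<in> funs.span (N ` (F \<union> (C - {i})))"
proof (rule ccontr)
  assume "\<not> ?thesis"
  moreover have "indep_over N F (C - {i})"
    using assms by (auto simp: contraction_circuits_def contraction_def)
  ultimately have "indep_over N F (insert i (C - {i}))"
    using finite_circuit[OF assms(1)] by (subst indep_over_insert) auto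
  moreover have "insert i (C - {i}) = C" using assms by auto
  ultimately show False
    using assms by (auto simp: contraction_circuits_def contraction_def)
qed

lemma dependent_contains_circuit:
  assumes "S \<subseteq> E - F" "S \<notin> contraction F"
  obtains C where "C \<in> contraction_circuits F" "C \<subseteq> S"
proof -
  have "finite S" using assms(1) finite_E finite_subset by blast
  then have "\<exists>C\<in>contraction_circuits F. C \<subseteq> S"
    using assms
  proof (induction S rule: finite_psubset_induct)
    case (psubset S)
    show ?case
    proof (cases "\<forall>D. D \<subset> S \<longrightarrow> D \<in> contraction F")
      case True
      then have "S \<in> contraction_circuits F"
        using psubset.prems by (simp add: contraction_circuits_def)
      then show ?thesis by blast
    next
      case False
      then obtain D where "D \<subset> S" "D \<notin> contraction F" by blast
      then have "\<exists>C\<in>contraction_circuits F. C \<subseteq> D"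
        using psubset by blast
      then show ?thesis using \<open>D \<subset> S\<close> by blast
    qed
  qed
  then show ?thesis using that by blast
qed

lemma empty_in_contraction: "{} \<in> contraction F"
  by (simp add: contraction_def)

text \<open>Evaluates the exponent \<open>\<rho>\<close> of \<open>h_polynomial\<close> for a
  matroid complex: independent sets have at most rank many elements, and a spanning one attains the
  rank.\<close>

lemma Max_card_contraction_empty: "Max (card ` contraction {}) = rk E"
proof (rule Max_eqI)
  show "finite (card ` contraction {})" by simp
  show "k \<le> rk E" if k: "k \<in> card ` contraction {}" for k
  proof -
    obtain S where S: "S \<in> contraction {}" "k = card S" using k by blast
    then have "S \<subseteq> E" by (simp add: contraction_def)
    then show ?thesis using rk_mono[of S E] rk_eq_card[OF S(1)] S(2) by simp
  qed
  obtain S where S: "S \<subseteq> E" "indep_over N {} S" "N ` E \<subseteq> funs.span (N ` S)"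
    using ex_indep_over_spanning[OF finite_E, of N "{}"] by auto
  then have "S \<in> contraction {}" by (simp add: contraction_def)
  moreover have "rk E \<le> rk S"
    unfolding rk_def using S finite_subset[OF S(1) finite_E] by (intro dim_mono_finite) auto
  ultimately show "rk E \<in> card ` contraction {}"
    using rk_eq_card[of S] rk_mono[OF S(1)] by force
qed

section \<open>The broken circuit complex at a flat\<close>

context
  fixes F :: "'i set" and r :: "'i rel"
  assumes F: "F \<in> flat_sets" and r: "linear_order_on (E - F) r"
begin

text \<open>A dependent set contains a circuit, hence also that circuit without its minimum.\<close>

lemma nbc_subset_contraction:
  assumes "S \<in> nbc F r"
  shows "S \<in> contraction F"
proof (rule ccontr)
  assume "S \<notin> contraction F"
  moreover have "S \<subseteq> E - F" using assms by (simp add: nbc_def)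
  ultimately obtain C where C: "C \<in> contraction_circuits F" "C \<subseteq> S"
    using dependent_contains_circuit by blast
  then have "C \<noteq> {}"
    using empty_in_contraction by (auto simp: contraction_circuits_def)
  then obtain m where "m \<in> C" "\<forall>j\<in>C. (m, j) \<in> r"
    using linear_order_on_finite_min[OF r finite_circuit[OF C(1)]] C
    by (auto simp: contraction_circuits_def)
  moreover have "C - {m} \<subseteq> S" using C by blast
  ultimately show False using assms C(1) unfolding nbc_def by blast
qed

text \<open>A one-element circuit would lie in \<open>cl F\<close> but outside \<open>F\<close>, and
  \<open>F\<close> is closed. Hence no broken circuit is empty and \<open>{}\<close> is a
  face.\<close>

lemma circuit_not_singleton:
  assumes "C \<in> contraction_circuits F" "i \<in> C"
  shows "C - {i} \<noteq> {}"
proof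
  assume "C - {i} = {}"
  then have "N i \<in> funs.span (N ` F)"
    using circuit_span[OF assms] by (metis Un_empty_right)
  then have "i \<in> cl F" "i \<notin> F"
    using assms by (auto simp: cl_def contraction_circuits_def)
  then show False using F by (simp add: flat_sets_def)
qed

lemma empty_in_nbc: "{} \<in> nbc F r"
  using circuit_not_singleton by (auto simp: nbc_def)

text \<open>The first element \<open>m\<close> of \<open>H - F\<close> lies in no broken circuit inside \<open>H\<close>, so adding or
  removing \<open>m\<close> is a sign-reversing involution of the faces inside \<open>H\<close>.\<close>

lemma sum_sign_nbc:
  assumes H: "H \<in> flat_sets" "F \<subseteq> H"
  shows "(\<Sum>S\<in>{S \<in> nbc F r. S \<subseteq> H}. (- 1) ^ card S) = (if F = H then 1 else 0 :: int)"
proof (cases "F = H")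
  case True
  then have "{S \<in> nbc F r. S \<subseteq> H} = {{}}"
    using empty_in_nbc by (auto simp: nbc_def)
  then show ?thesis using True by simp
next
  case False
  have HE: "H \<subseteq> E" using H by (simp add: flat_sets_def)
  have "finite (H - F)" using HE finite_E finite_subset by blast
  then obtain m where m: "m \<in> H - F" "\<forall>j\<in>H - F. (m, j) \<in> r"
    using linear_order_on_finite_min[OF r, of "H - F"] False H HE by blast
  \<comment> \<open>The rest of the circuit spans \<open>i\<close> modulo \<open>F\<close>, so
    \<open>i\<close> lies in the flat \<open>H\<close>. Then \<open>m\<close> precedes
    \<open>i\<close> as the first element of \<open>H - F\<close>, and \<open>i\<close> precedes
    \<open>m\<close> as the minimum of \<open>C\<close>.\<close>
  have no_m: "m \<notin> C - {i}"
    if C: "C \<in> contraction_circuits F" "i \<in> C" "\<forall>j\<in>C. (i, j) \<in> r" "C - {i} \<subseteq> H" for C i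
  proof
    assume "m \<in> C - {i}"
    have "F \<union> (C - {i}) \<subseteq> H" using C H by auto
    then have "N i \<in> funs.span (N ` H)"
      using circuit_span[OF C(1,2)] funs.span_mono[OF image_mono] by blast
    then have "i \<in> cl H" using C by (auto simp: cl_def contraction_circuits_def)
    then have "i \<in> H - F"
      using H C by (auto simp: flat_sets_def contraction_circuits_def)
    then have "(m, i) \<in> r" "(i, m) \<in> r" using m C \<open>m \<in> C - {i}\<close> by auto
    then have "m = i"
      using r by (auto simp: order_on_defs dest: antisymD)
    then show False using \<open>m \<in> C - {i}\<close> by simp
  qed
  define P where "P = {S \<in> nbc F r. S \<subseteq> H \<and> m \<notin> S}"
  have ins: "insert m S \<in> nbc F r \<longleftrightarrow> S \<in> nbc F r" if "S \<subseteq> H" for S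
  proof -
    have "C - {i} \<subseteq> insert m S \<longleftrightarrow> C - {i} \<subseteq> S"
      if "C \<in> contraction_circuits F" "i \<in> C" "\<forall>j\<in>C. (i, j) \<in> r" for C i
      using no_m[OF that] \<open>S \<subseteq> H\<close> m by blast
    moreover have "insert m S \<subseteq> E - F \<longleftrightarrow> S \<subseteq> E - F" using m HE by auto
    ultimately show ?thesis unfolding nbc_def by auto
  qed
  have split: "{S \<in> nbc F r. S \<subseteq> H} = P \<union> insert m ` P"
  proof safe
    fix S assume S: "S \<in> nbc F r" "S \<subseteq> H" "S \<notin> insert m ` P"
    have "m \<in> S \<Longrightarrow> S = insert m (S - {m})" by auto
    moreover have "m \<in> S \<Longrightarrow> S - {m} \<in> P"
      using ins[of "S - {m}"] S by (auto simp: P_def insert_absorb)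
    ultimately have "m \<notin> S" using S by blast
    then show "S \<in> P" using S by (simp add: P_def)
  qed (use ins m in \<open>auto simp: P_def\<close>)
  have fin: "finite P" by (simp add: P_def)
  have "inj_on (insert m) P"
    by (auto simp: inj_on_def P_def)
  moreover have "finite S" "m \<notin> S" if "S \<in> P" for S
    using that finite_subset[OF _ finite_E] HE by (auto simp: P_def)
  moreover have "P \<inter> insert m ` P = {}" by (auto simp: P_def)
  ultimately have "(\<Sum>S\<in>{S \<in> nbc F r. S \<subseteq> H}. (- 1) ^ card S) =
      (\<Sum>S\<in>P. (- 1) ^ card S) + (\<Sum>S\<in>P. - ((- 1 :: int) ^ card S))"
    unfolding split using fin by (simp add: sum.union_disjoint sum.reindex)
  then show ?thesis using False by (simp add: sum_negf)
qed

text \<open>A face of maximal size is the lexicographically first basis: its elements are those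
  independent of their predecessors.\<close>

lemma ex_nbc_spanning: "\<exists>T\<in>nbc F r. rk E = rk F + card T"
proof -
  define pre where "pre e = {x \<in> E - F. (x, e) \<in> r \<and> x \<noteq> e}" for e
  define T where "T = {e \<in> E - F. N e \<notin> funs.span (N ` (F \<union> pre e))}"
  have ord: "refl_on (E - F) r" "trans r" "antisym r" "total_on (E - F) r"
    using r by (auto simp: order_on_defs)
  have T: "T \<in> nbc F r"
  proof (rule ccontr)
    assume "T \<notin> nbc F r"
    then obtain C i where C: "C \<in> contraction_circuits F" "i \<in> C" "\<forall>j\<in>C. (i, j) \<in> r"
      "C - {i} \<subseteq> T"
      unfolding nbc_def T_def by blast
    have CE: "C \<subseteq> E - F" using C by (simp add: contraction_circuits_def)
    \<comment> \<open>A minimum for the converse order makes \<open>e\<close> the largest element of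
      \<open>C - {i}\<close>. Since \<open>i\<close> is the minimum of \<open>C\<close>, all of
      \<open>C - {e}\<close> precedes \<open>e\<close> and spans it modulo \<open>F\<close>, against
      \<open>e \<in> T\<close>.\<close>
    have "linear_order_on (E - F) (r\<inverse>)" using r by simp
    then obtain e where e: "e \<in> C - {i}" "\<forall>j\<in>C - {i}. (j, e) \<in> r"
      using linear_order_on_finite_min[of "E - F" "r\<inverse>" "C - {i}"] finite_circuit[OF C(1)]
        circuit_not_singleton[OF C(1,2)] CE by auto
    have "F \<union> (C - {e}) \<subseteq> F \<union> pre e"
      using e C CE by (auto simp: pre_def)
    then have "N e \<in> funs.span (N ` (F \<union> pre e))"
      using circuit_span[OF C(1), of e] e funs.span_mono[OF image_mono] by blast
    moreover have "e \<in> T" using e C by auto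
    ultimately show False by (simp add: T_def)
  qed
  have FE: "F \<subseteq> E" using F by (simp add: flat_sets_def)
  have TE: "T \<subseteq> E - F" by (auto simp: T_def)
  have span: "N e \<in> funs.span (N ` (F \<union> T))" if "e \<in> E" for e
  proof (rule ccontr)
    assume bad: "N e \<notin> funs.span (N ` (F \<union> T))"
    \<comment> \<open>Elements missed by the span. All predecessors of the first one,
      \<open>m\<close>, are spanned by \<open>F \<union> T\<close>; as \<open>m \<notin> T\<close>,
      its vector is in the span of \<open>F\<close> and these predecessors, a contradiction.\<close>
    define B where "B = {e \<in> E - F. N e \<notin> funs.span (N ` (F \<union> T))}"
    have "e \<in> B"
      using bad that by (auto simp: B_def intro: funs.span_base)
    then obtain m where m: "m \<in> B" "\<forall>j\<in>B. (m, j) \<in> r"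
      using linear_order_on_finite_min[OF r, of B] finite_E by (auto simp: B_def)
    have "pre m \<inter> B = {}"
      using m ord(3) by (auto simp: pre_def dest: antisymD)
    then have "N ` (F \<union> pre m) \<subseteq> funs.span (N ` (F \<union> T))"
      by (auto simp: B_def pre_def intro: funs.span_base)
    then have "funs.span (N ` (F \<union> pre m)) \<subseteq> funs.span (N ` (F \<union> T))"
      by (simp add: funs.span_minimal)
    moreover have "m \<notin> T"
      using m by (auto simp: B_def intro: funs.span_base)
    ultimately show False
      using m by (auto simp: T_def B_def)
  qed
  have "rk E = rk (F \<union> T)"
  proof (rule antisym)
    show "rk E \<le> rk (F \<union> T)"
      unfolding rk_def using span FE TE finite_subset[OF _ finite_E, of "F \<union> T"]
      by (intro dim_mono_finite) auto
    show "rk (F \<union> T) \<le> rk E" using FE TE by (intro rk_mono) auto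
  qed
  also have "\<dots> = rk F + card T"
    using rk_Un_contraction[OF FE nbc_subset_contraction[OF T]] .
  finally show ?thesis using T by blast
qed

text \<open>The exponent \<open>\<rho>\<close> for the restriction: faces are independent over
  \<open>F\<close>, which bounds their size, and the lexicographically first basis attains the
  bound.\<close>

lemma Max_card_nbc: "Max (card ` nbc F r) = rk E - rk F"
proof (rule Max_eqI)
  have FE: "F \<subseteq> E" using F by (simp add: flat_sets_def)
  show "finite (card ` nbc F r)" by simp
  show "k \<le> rk E - rk F" if k: "k \<in> card ` nbc F r" for k
  proof -
    obtain S where S: "S \<in> nbc F r" "k = card S" using k by blast
    then have "rk (F \<union> S) \<le> rk E" using FE by (intro rk_mono) (auto simp: nbc_def)
    then show ?thesis
      using S rk_Un_contraction[OF FE nbc_subset_contraction[OF S(1)]] by simp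
  qed
  obtain T where "T \<in> nbc F r" "rk E = rk F + card T"
    using ex_nbc_spanning by blast
  then show "rk E - rk F \<in> card ` nbc F r" by force
qed

end

section \<open>Sums over the lattice of flats\<close>

lemma sum_group_flat_sets:
  assumes "finite A" "c ` A \<subseteq> flat_sets"
  shows "(\<Sum>G | G \<in> flat_sets \<and> G \<subseteq> H. \<Sum>S | S \<in> A \<and> c S = G. f S) =
    (\<Sum>S | S \<in> A \<and> c S \<subseteq> H. f S :: int)"
proof -
  have "(\<Sum>G | G \<in> flat_sets \<and> G \<subseteq> H. \<Sum>S | S \<in> A \<and> c S = G. f S) =
      (\<Sum>G | G \<in> flat_sets \<and> G \<subseteq> H. \<Sum>S | S \<in> {S \<in> A. c S \<subseteq> H} \<and> c S = G. f S)"
    by (intro sum.cong) auto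
  also have "\<dots> = (\<Sum>S | S \<in> A \<and> c S \<subseteq> H. f S)"
    using assms by (intro sum.group) auto
  finally show ?thesis .
qed

text \<open>Induction along inclusion: in the sum over the flats inside \<open>H\<close>, all terms
  except the one at \<open>H\<close> cancel by the induction hypothesis.\<close>

lemma flat_sets_sums_eqD:
  fixes f g :: "'i set \<Rightarrow> int"
  assumes sums: "\<And>H. H \<in> flat_sets \<Longrightarrow>
      (\<Sum>G | G \<in> flat_sets \<and> G \<subseteq> H. f G) = (\<Sum>G | G \<in> flat_sets \<and> G \<subseteq> H. g G)"
    and G: "G \<in> flat_sets"
  shows "f G = g G"
proof -
  have "finite G" using flat_sets_subset[OF G] finite_E finite_subset by blast
  then show ?thesis
    using G
  proof (induction G rule: finite_psubset_induct)
    case (psubset H)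
    have split: "{G. G \<in> flat_sets \<and> G \<subseteq> H} = insert H {G. G \<in> flat_sets \<and> G \<subset> H}"
      using psubset.prems by auto
    have "(\<Sum>G | G \<in> flat_sets \<and> G \<subset> H. f G) = (\<Sum>G | G \<in> flat_sets \<and> G \<subset> H. g G)"
      using psubset.IH by (intro sum.cong refl) blast
    then show ?case
      using sums[OF psubset.prems] unfolding split by simp
  qed
qed

text \<open>Both sides have the same sums over the intervals \<open>{G. G \<subseteq> H}\<close>, by \<open>sum_sign_nbc\<close> on the left;
  this replaces Moebius inversion in the lattice of flats.\<close>

lemma sum_nbc_convolution:
  assumes r: "\<And>F. F \<in> flat_sets \<Longrightarrow> linear_order_on (E - F) (r F)"
    and G: "G \<in> flat_sets"
  shows "(\<Sum>F\<in>flat_sets. (\<Sum>S | S \<in> contraction {} \<and> S \<subseteq> F. (- 1) ^ card S) *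
      (\<Sum>S | S \<in> nbc F (r F) \<and> cl (F \<union> S) = G. (- 1) ^ card S)) =
    (\<Sum>S | S \<in> contraction {} \<and> cl S = G. (- 1 :: int) ^ card S)"
  (is "?k G = ?j G")
proof -
  define i where "i F = (\<Sum>S | S \<in> contraction {} \<and> S \<subseteq> F. (- 1 :: int) ^ card S)" for F
  \<comment> \<open>Regrouping by closure leaves the faces inside \<open>H\<close>, to which
    \<open>sum_sign_nbc\<close> applies. If \<open>F\<close> is not inside \<open>H\<close>, no face
    remains, and both sides are 0.\<close>
  have inner: "(\<Sum>G | G \<in> flat_sets \<and> G \<subseteq> H.
      \<Sum>S | S \<in> nbc F (r F) \<and> cl (F \<union> S) = G. (- 1 :: int) ^ card S) = (if F = H then 1 else 0)"
    if F: "F \<in> flat_sets" and H: "H \<in> flat_sets" for F H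
  proof -
    have FE: "F \<subseteq> E" using F by (rule flat_sets_subset)
    have "(\<Sum>G | G \<in> flat_sets \<and> G \<subseteq> H.
        \<Sum>S | S \<in> nbc F (r F) \<and> cl (F \<union> S) = G. (- 1 :: int) ^ card S) =
        (\<Sum>S | S \<in> nbc F (r F) \<and> cl (F \<union> S) \<subseteq> H. (- 1) ^ card S)"
    proof (rule sum_group_flat_sets)
      show "(\<lambda>S. cl (F \<union> S)) ` nbc F (r F) \<subseteq> flat_sets"
        using FE by (auto simp: nbc_def intro!: cl_in_flat_sets)
    qed simp
    also have "{S. S \<in> nbc F (r F) \<and> cl (F \<union> S) \<subseteq> H} =
        (if F \<subseteq> H then {S \<in> nbc F (r F). S \<subseteq> H} else {})"
    proof -
      have "cl (F \<union> S) \<subseteq> H \<longleftrightarrow> F \<subseteq> H \<and> S \<subseteq> H" if "S \<in> nbc F (r F)" for S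
        using that FE by (subst cl_subset_flat_iff[OF H]) (auto simp: nbc_def)
      then show ?thesis by auto
    qed
    finally show ?thesis
      using sum_sign_nbc[OF F r[OF F] H] by (auto split: if_splits)
  qed
  have sums: "(\<Sum>G | G \<in> flat_sets \<and> G \<subseteq> H. ?k G) = (\<Sum>G | G \<in> flat_sets \<and> G \<subseteq> H. ?j G)"
    if H: "H \<in> flat_sets" for H
  proof -
    \<comment> \<open>After exchanging the sums only \<open>F = H\<close> survives; its independent
      sets are then regrouped by closure.\<close>
    have "(\<Sum>G | G \<in> flat_sets \<and> G \<subseteq> H. ?k G) =
      (\<Sum>F\<in>flat_sets. i F * (\<Sum>G | G \<in> flat_sets \<and> G \<subseteq> H.
        \<Sum>S | S \<in> nbc F (r F) \<and> cl (F \<union> S) = G. (- 1) ^ card S))"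
      unfolding i_def[symmetric] sum_distrib_left by (rule sum.swap)
    also have "\<dots> = (\<Sum>F\<in>flat_sets. if F = H then i F else 0)"
      using inner H by (intro sum.cong refl) simp
    also have "\<dots> = i H"
      using H by simp
    also have "\<dots> = (\<Sum>S | S \<in> contraction {} \<and> cl S \<subseteq> H. (- 1) ^ card S)"
      unfolding i_def using H
      by (intro sum.cong refl Collect_cong conj_cong cl_subset_flat_iff[symmetric])
        (auto simp: contraction_def)
    also have "\<dots> = (\<Sum>G | G \<in> flat_sets \<and> G \<subseteq> H. ?j G)"
      by (rule sum_group_flat_sets[symmetric, OF finite_contraction])
        (auto simp: contraction_def intro: cl_in_flat_sets)
    finally show ?thesis .
  qed
  show ?thesis
    by (rule flat_sets_sums_eqD[where f = ?k and g = ?j, OF sums G])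
qed

end

section \<open>Restriction and localization\<close>

text \<open>One identity covers additivity and homogeneity; \<open>v = w = 0\<close> with
  \<open>c = 1\<close> gives \<open>f 0 = 0\<close>. Vanishing outside the space makes functionals
  that agree on it equal as functions.\<close>

definition linear_functional :: "nat \<Rightarrow> (real vec \<Rightarrow> real) \<Rightarrow> bool"
  where "linear_functional d f \<longleftrightarrow>
    (\<forall>v\<in>carrier_vec d. \<forall>w\<in>carrier_vec d. \<forall>c. f (v + c \<cdot>\<^sub>v w) = f v + c * f w) \<and>
    (\<forall>v. v \<notin> carrier_vec d \<longrightarrow> f v = 0)"

lemma linear_functional_diff_scale:
  "linear_functional d f \<Longrightarrow> linear_functional d g \<Longrightarrow> linear_functional d (f - fun_scale k g)"
  by (auto simp: linear_functional_def fun_scale_def algebra_simps)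

lemma linear_functional_sum:
  assumes "\<And>i. i \<in> S \<Longrightarrow> linear_functional d (f i)"
  shows "linear_functional d (\<Sum>i\<in>S. fun_scale (c i) (f i))"
  using assms
  by (auto simp: linear_functional_def fun_scale_def sum_fun_apply algebra_simps sum.distrib
    sum_distrib_left)

text \<open>Double annihilator argument by induction on \<open>K\<close>. Either \<open>g\<close>
  already vanishes on the common kernel of the others, or some \<open>u\<close> there has
  \<open>g u \<noteq> 0\<close> and a multiple of \<open>g\<close> is subtracted from
  \<open>f\<close> to kill the value at \<open>u\<close>.\<close>

lemma in_span_if_vanishes_on_kernel:
  assumes "finite K" "\<And>g. g \<in> K \<Longrightarrow> linear_functional d g" "linear_functional d f"
    and "\<And>v. v \<in> carrier_vec d \<Longrightarrow> \<forall>g\<in>K. g v = 0 \<Longrightarrow> f v = 0"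
  shows "f \<in> funs.span K"
  using assms
proof (induction K arbitrary: f rule: finite_induct)
  case empty
  then have "f = 0" by (auto simp: linear_functional_def fun_eq_iff)
  then show ?case using funs.span_zero by blast
next
  case (insert g K)
  show ?case
  proof (cases "\<exists>u\<in>carrier_vec d. (\<forall>h\<in>K. h u = 0) \<and> g u \<noteq> 0")
    case False
    then have "f \<in> funs.span K"
      using insert.prems by (intro insert.IH) auto
    then show ?thesis using funs.span_mono[of K "insert g K"] by blast
  next
    case True
    then obtain u where u: "u \<in> carrier_vec d" "\<forall>h\<in>K. h u = 0" "g u \<noteq> 0" by blast
    have lin: "h (v + c \<cdot>\<^sub>v u) = h v + c * h u"
      if "linear_functional d h" "v \<in> carrier_vec d" for h v c
      using that u(1) by (auto simp: linear_functional_def)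
    have "f - fun_scale (f u / g u) g \<in> funs.span K"
    proof (rule insert.IH)
      show "linear_functional d (f - fun_scale (f u / g u) g)"
        using insert.prems by (intro linear_functional_diff_scale) auto
      fix v assume v: "v \<in> carrier_vec d" "\<forall>h\<in>K. h v = 0"
      \<comment> \<open>Projection of \<open>v\<close> along \<open>u\<close> into the kernel of
        \<open>g\<close>; it stays in the kernel of \<open>K\<close>.\<close>
      let ?w = "v + (- (g v / g u)) \<cdot>\<^sub>v u"
      have "g ?w = 0"
        using lin[of g v] insert.prems(1) v(1) u(3) by (simp add: field_simps)
      moreover have "h ?w = 0" if "h \<in> K" for h
      proof -
        have "h v = 0" "h u = 0" using that v u by blast+
        then show ?thesis using lin[of h v] insert.prems(1) that v(1) by simp
      qed
      ultimately have "f ?w = 0"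
        using insert.prems(3)[of ?w] v(1) u(1) by auto
      then show "(f - fun_scale (f u / g u) g) v = 0"
        using lin[of f v] insert.prems(2) v(1) by (simp add: fun_scale_def field_simps)
    qed (use insert.prems in auto)
    then show ?thesis unfolding funs.span_breakdown_eq by blast
  qed
qed

locale vec_arrangement =
  fixes B :: "('i, real vec) arrangement" and d :: nat
  assumes finite_indices: "finite (indices B)"
    and ambient: "ambient B = carrier_vec d"
    and functional: "\<And>i. i \<in> indices B \<Longrightarrow> linear_functional d (normal B i)"
begin

sublocale vector_family "indices B" "normal B"
  using finite_indices by unfold_locales

lemma mem_hyperplane_Int:
  "v \<in> hyperplane_Int B F \<longleftrightarrow> v \<in> carrier_vec d \<and> (\<forall>i\<in>F. normal B i v = 0)"
  by (auto simp: hyperplane_Int_def hyperplane_def ambient)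

text \<open>The bridge between intersections of hyperplanes and spans of normal vectors, used for
  both flats and restrictions.\<close>

lemma in_span_iff_vanishes:
  assumes "F \<subseteq> indices B" "linear_functional d f"
  shows "f \<in> funs.span (normal B ` F) \<longleftrightarrow> (\<forall>v\<in>hyperplane_Int B F. f v = 0)"
proof
  assume "f \<in> funs.span (normal B ` F)"
  then show "\<forall>v\<in>hyperplane_Int B F. f v = 0"
    by (induction rule: funs.span_induct_alt) (auto simp: fun_scale_def mem_hyperplane_Int)
next
  assume "\<forall>v\<in>hyperplane_Int B F. f v = 0"
  then show "f \<in> funs.span (normal B ` F)"
    using assms functional finite_subset[OF _ finite_indices]
    by (intro in_span_if_vanishes_on_kernel) (auto simp: mem_hyperplane_Int)
qed

lemma flats_eq: "flats B = flat_sets"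
proof -
  have "hyperplane_Int B F \<subseteq> hyperplane B i \<longleftrightarrow> normal B i \<in> funs.span (normal B ` F)"
    if "F \<subseteq> indices B" "i \<in> indices B" for F i
    using in_span_iff_vanishes[OF that(1) functional[OF that(2)]]
    by (auto simp: hyperplane_def mem_hyperplane_Int ambient)
  then have "{i \<in> indices B. hyperplane_Int B F \<subseteq> hyperplane B i} = cl F" if "F \<subseteq> indices B" for F
    using that by (auto simp: cl_def)
  then show ?thesis
    unfolding flats_def flat_sets_def by (metis (no_types, lifting))
qed

lemma matroid_complex_eq: "matroid_complex B = contraction {}"
  unfolding matroid_complex_def contraction_def
  using indep_over_empty_iff[of _ "normal B"] finite_subset[OF _ finite_indices] by auto

text \<open>A combination of restricted functionals is zero iff the original combination vanishes on
  \<open>hyperplane_Int B F\<close>, that is, lies in the span of the normals of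
  \<open>F\<close>.\<close>

lemma matroid_complex_restriction:
  assumes "F \<subseteq> indices B"
  shows "matroid_complex (restriction B F) = contraction F"
proof -
  let ?R = "restriction B F"
  have "inj_on (normal ?R) S \<and> funs.independent (normal ?R ` S) \<longleftrightarrow> indep_over (normal B) F S"
    if S: "S \<subseteq> indices B" for S
  proof -
    have fin: "finite S" using S finite_indices finite_subset by blast
    have "(\<Sum>i\<in>S. fun_scale (c i) (normal ?R i)) \<in> funs.span (normal ?R ` {}) \<longleftrightarrow>
        (\<Sum>i\<in>S. fun_scale (c i) (normal B i)) \<in> funs.span (normal B ` F)" for c
    proof -
      have lin: "linear_functional d (\<Sum>i\<in>S. fun_scale (c i) (normal B i))"
        using S functional by (intro linear_functional_sum) auto
      have "(\<Sum>i\<in>S. fun_scale (c i) (normal ?R i)) v =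
          (if v \<in> hyperplane_Int B F then (\<Sum>i\<in>S. fun_scale (c i) (normal B i)) v else 0)" for v
        by (simp add: sum_fun_apply fun_scale_def restriction_def)
      then show ?thesis
        unfolding in_span_iff_vanishes[OF assms lin] by (auto simp: fun_eq_iff)
    qed
    then show ?thesis
      unfolding indep_over_empty_iff[OF fin, symmetric] indep_over_def by simp
  qed
  moreover have "indices ?R = indices B - F" by (simp add: restriction_def)
  ultimately show ?thesis
    unfolding matroid_complex_def contraction_def by auto
qed

lemma bc_complex_restriction:
  assumes "F \<subseteq> indices B"
  shows "bc_complex (restriction B F) r = nbc F r"
proof -
  have ind: "indices (restriction B F) = indices B - F" by (simp add: restriction_def)
  have "circuits (restriction B F) = contraction_circuits F"
    unfolding circuits_def contraction_circuits_def ind matroid_complex_restriction[OF assms] ..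
  moreover have "(\<forall>X\<in>{f C i | C i. C \<in> K \<and> i \<in> C \<and> R C i}. Q X) \<longleftrightarrow>
      (\<forall>C\<in>K. \<forall>i\<in>C. R C i \<longrightarrow> Q (f C i))" for f :: "'i set \<Rightarrow> 'i \<Rightarrow> 'i set" and K R Q
    by auto
  ultimately show ?thesis
    unfolding bc_complex_def nbc_def broken_circuits_def ind by simp
qed

lemma normal_localization:
  assumes "F \<subseteq> indices B" "i \<in> F" "v \<in> carrier_vec d"
  shows "normal (localization B F) i ((\<lambda>w. v + w) ` hyperplane_Int B F) = normal B i v"
proof -
  have lin: "linear_functional d (normal B i)" using assms functional by auto
  have "normal B i (v + w) = normal B i v" if "w \<in> hyperplane_Int B F" for w
  proof -
    have w: "w \<in> carrier_vec d" "normal B i w = 0"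
      using that assms(2) by (auto simp: mem_hyperplane_Int)
    then have "normal B i (v + 1 \<cdot>\<^sub>v w) = normal B i v + 1 * normal B i w"
      using lin assms(3) unfolding linear_functional_def by blast
    then show ?thesis by (simp add: w(2))
  qed
  \<comment> \<open>Makes the coset nonempty, so the set of values is a singleton and
    \<open>the_elem\<close> returns its element.\<close>
  moreover have "0\<^sub>v d \<in> hyperplane_Int B F"
  proof -
    have "normal B j (0\<^sub>v d) = 0" if "j \<in> F" for j
    proof -
      have "normal B j (0\<^sub>v d + 1 \<cdot>\<^sub>v 0\<^sub>v d) = normal B j (0\<^sub>v d) + 1 * normal B j (0\<^sub>v d)"
        using functional[of j] that assms(1) zero_carrier_vec[of d]
        unfolding linear_functional_def by blast
      then show ?thesis by simp
    qed
    then show ?thesis by (simp add: mem_hyperplane_Int)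
  qed
  ultimately have "normal B i ` (\<lambda>w. v + w) ` hyperplane_Int B F = {normal B i v}"
    by (auto simp: image_image)
  then show ?thesis
    using assms(3) by (auto simp: localization_def cosets_def ambient Let_def)
qed

text \<open>The induced functionals satisfy the same linear relations as the originals: every coset
  has a representative, and outside their domains all of them are 0.\<close>

lemma matroid_complex_localization:
  assumes "F \<subseteq> indices B"
  shows "matroid_complex (localization B F) = {S \<in> contraction {}. S \<subseteq> F}"
proof -
  let ?L = "localization B F"
  have "inj_on (normal ?L) S \<and> funs.independent (normal ?L ` S) \<longleftrightarrow> indep_over (normal B) {} S"
    if S: "S \<subseteq> F" for S
  proof -
    have fin: "finite S" using finite_subset[OF S finite_subset[OF assms finite_indices]] .
    have "(\<Sum>i\<in>S. fun_scale (c i) (normal ?L i)) = 0 \<longleftrightarrow>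
        (\<Sum>i\<in>S. fun_scale (c i) (normal B i)) = 0" for c
    proof -
      have coset: "(\<Sum>i\<in>S. c i * normal ?L i ((\<lambda>w. v + w) ` hyperplane_Int B F)) =
          (\<Sum>i\<in>S. c i * normal B i v)" if "v \<in> carrier_vec d" for v
        using S that by (intro sum.cong refl) (auto simp: normal_localization[OF assms])
      let ?Q = "cosets (carrier_vec d) (hyperplane_Int B F)"
      have zero_L: "(\<Sum>i\<in>S. c i * normal ?L i X) = 0" if "X \<notin> ?Q" for X
        using that by (simp add: localization_def ambient Let_def)
      have zero_B: "(\<Sum>i\<in>S. c i * normal B i v) = 0" if "v \<notin> carrier_vec d" for v
        using that S assms functional by (intro sum.neutral) (auto simp: linear_functional_def)
      have "(\<forall>X. (\<Sum>i\<in>S. c i * normal ?L i X) = 0) \<longleftrightarrow>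
          (\<forall>X\<in>?Q. (\<Sum>i\<in>S. c i * normal ?L i X) = 0)"
        using zero_L by blast
      also have "\<dots> \<longleftrightarrow> (\<forall>v\<in>carrier_vec d. (\<Sum>i\<in>S. c i * normal B i v) = 0)"
        by (simp add: cosets_def coset)
      also have "\<dots> \<longleftrightarrow> (\<forall>v. (\<Sum>i\<in>S. c i * normal B i v) = 0)"
        using zero_B by blast
      finally have "(\<forall>X. (\<Sum>i\<in>S. c i * normal ?L i X) = 0) \<longleftrightarrow>
          (\<forall>v. (\<Sum>i\<in>S. c i * normal B i v) = 0)" .
      then show ?thesis
        by (simp add: fun_eq_iff sum_fun_apply fun_scale_def)
    qed
    then show ?thesis
      unfolding indep_over_empty_iff[OF fin, symmetric] indep_over_def by simp
  qed
  moreover have "indices ?L = F" by (simp add: localization_def Let_def)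
  ultimately show ?thesis
    using assms unfolding matroid_complex_def contraction_def by auto
qed

lemma Max_card_contraction_inside:
  assumes "F \<subseteq> indices B"
  shows "Max (card ` {S \<in> contraction {}. S \<subseteq> F}) = rk F"
proof -
  interpret L: vector_family F "normal B"
    using assms finite_indices finite_subset by unfold_locales blast
  have "L.contraction {} = {S \<in> contraction {}. S \<subseteq> F}"
    using assms by (auto simp: L.contraction_def contraction_def)
  then show ?thesis
    using L.Max_card_contraction_empty by (simp add: L.rk_def rk_def)
qed

text \<open>The two ranks live in different function spaces; they are compared through the maximal
  size of independent sets, which are the same on both sides.\<close>

lemma flat_rank_eq:
  assumes "F \<subseteq> indices B"
  shows "flat_rank B F = rk F"
proof -
  interpret L: vector_family F "normal (localization B F)"
    using assms finite_indices finite_subset by unfold_locales blast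
  have ind: "indices (localization B F) = F" by (simp add: localization_def Let_def)
  have "L.contraction {} = matroid_complex (localization B F)"
    unfolding matroid_complex_def L.contraction_def ind
    using indep_over_empty_iff finite_subset[OF _ L.finite_E] by auto
  then have "flat_rank B F = Max (card ` matroid_complex (localization B F))"
    using L.Max_card_contraction_empty by (simp add: flat_rank_def arr_rank_def ind L.rk_def)
  then show ?thesis
    using matroid_complex_localization[OF assms] Max_card_contraction_inside[OF assms] by simp
qed

end

section \<open>The convolution formula\<close>

lemma h_polynomial_eq:
  assumes "finite \<Delta>" "Max (card ` \<Delta>) = \<rho>"
  shows "h_polynomial \<Delta> = (\<Sum>S\<in>\<Delta>. [:0, 1:] ^ card S * [:1, - 1:] ^ (\<rho> - card S))"
proof -
  have "h_polynomial \<Delta> =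
      (\<Sum>i\<le>\<rho>. \<Sum>S | S \<in> \<Delta> \<and> card S = i. [:0, 1:] ^ card S * [:1, - 1:] ^ (\<rho> - card S))"
    unfolding h_polynomial_def Let_def assms(2) by (intro sum.cong refl) simp
  also have "\<dots> = (\<Sum>S\<in>\<Delta>. [:0, 1:] ^ card S * [:1, - 1:] ^ (\<rho> - card S))"
    using assms by (intro sum.group) auto
  finally show ?thesis .
qed

text \<open>The power of \<open>q\<close> shifts degrees, and \<open>(1 - q)\<close> to the
  \<open>\<rho> - k\<close> has leading coefficient -1 to that power. Thus the top
  \<open>h\<close>-number of a localization is a signed count of its faces.\<close>

lemma coeff_top_term:
  assumes "k \<le> \<rho>"
  shows "coeff ([:0, 1:] ^ k * [:1, - 1:] ^ (\<rho> - k) :: int poly) \<rho> = (- 1) ^ \<rho> * (- 1) ^ k"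
proof -
  have "[:0, 1 :: int:] ^ k = monom 1 k" by (simp add: monom_altdef)
  then have "coeff ([:0, 1:] ^ k * [:1, - 1:] ^ (\<rho> - k) :: int poly) \<rho> = (- 1) ^ (\<rho> - k)"
    using assms by (simp add: coeff_monom_mult)
  also have "\<dots> = (- 1) ^ (\<rho> + k)"
    using assms by (simp add: uminus_power_if)
  finally show ?thesis by (simp add: power_add)
qed

context vec_arrangement
begin

text \<open>Both sides are expanded in the polynomials \<open>P (rk G)\<close>, and the coefficients
  are matched by \<open>sum_nbc_convolution\<close>. The orders \<open>r F\<close> can be chosen
  separately since the sums in \<open>sum_sign_nbc\<close> do not depend on them.\<close>

theorem h_arr_convolution:
  assumes r: "\<And>F. F \<in> flats B \<Longrightarrow> linear_order_on (indices B - F) (r F)"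
  shows "h_arr B = (\<Sum>F\<in>flats B. h_br (restriction B F) (r F) *
    monom (coeff (h_arr (localization B F)) (flat_rank B F)) (flat_rank B F))"
proof -
  define X Y :: "int poly" where "X = [:0, 1:]" and "Y = [:1, - 1:]"
  define P where "P k = X ^ k * Y ^ (rk (indices B) - k)" for k
  define i where "i F = (\<Sum>S | S \<in> contraction {} \<and> S \<subseteq> F. (- 1 :: int) ^ card S)" for F
  define b where "b F G = (\<Sum>S | S \<in> nbc F (r F) \<and> cl (F \<union> S) = G. (- 1 :: int) ^ card S)" for F G
  have r': "linear_order_on (indices B - F) (r F)" if "F \<in> flat_sets" for F
    using r that by (simp add: flats_eq)
  have lhs: "h_arr B = (\<Sum>G\<in>flat_sets.
      of_int ((- 1) ^ rk G * (\<Sum>S | S \<in> contraction {} \<and> cl S = G. (- 1) ^ card S)) * P (rk G))"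
  proof -
    have "h_arr B = (\<Sum>S\<in>contraction {}. P (card S))"
      unfolding h_arr_def matroid_complex_eq P_def X_def Y_def
      by (rule h_polynomial_eq) (simp_all add: Max_card_contraction_empty)
    also have "\<dots> = (\<Sum>G\<in>flat_sets. \<Sum>S | S \<in> contraction {} \<and> cl S = G. P (card S))"
      by (rule sum.group[symmetric, OF finite_contraction finite_flat_sets])
        (auto simp: contraction_def intro: cl_in_flat_sets)
    \<comment> \<open>Here \<open>rk G = card S\<close>, so the two inserted signs multiply to 1;
      they produce the alternating sum of the convolution.\<close>
    also have "\<dots> = (\<Sum>G\<in>flat_sets. \<Sum>S | S \<in> contraction {} \<and> cl S = G.
        of_int ((- 1) ^ rk G * (- 1) ^ card S) * P (rk G))"
    proof (intro sum.cong refl)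
      fix G S assume "S \<in> {S. S \<in> contraction {} \<and> cl S = G}"
      then have S: "S \<in> contraction {}" "cl S = G" by auto
      then have "rk G = card S"
        using rk_cl[of S] rk_eq_card[OF S(1)] by (simp add: contraction_def)
      then show "P (card S) = of_int ((- 1) ^ rk G * (- 1) ^ card S) * P (rk G)"
        by simp
    qed
    finally show ?thesis by (simp add: sum_distrib_left sum_distrib_right)
  qed
  have rhs: "h_br (restriction B F) (r F) *
      monom (coeff (h_arr (localization B F)) (flat_rank B F)) (flat_rank B F) =
      (\<Sum>G\<in>flat_sets. of_int ((- 1) ^ rk G * (i F * b F G)) * P (rk G))" if F: "F \<in> flat_sets" for F
  proof -
    have FE: "F \<subseteq> indices B" using F by (rule flat_sets_subset)
    define e where "e = coeff (h_arr (localization B F)) (rk F)"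
    have "h_arr (localization B F) = (\<Sum>S | S \<in> contraction {} \<and> S \<subseteq> F.
        [:0, 1:] ^ card S * [:1, - 1:] ^ (rk F - card S))"
      unfolding h_arr_def matroid_complex_localization[OF FE]
      by (rule h_polynomial_eq) (simp_all add: Max_card_contraction_inside[OF FE])
    also have "coeff \<dots> (rk F) = (\<Sum>S | S \<in> contraction {} \<and> S \<subseteq> F. (- 1) ^ rk F * (- 1) ^ card S)"
      unfolding coeff_sum
    proof (intro sum.cong refl coeff_top_term)
      fix S assume "S \<in> {S. S \<in> contraction {} \<and> S \<subseteq> F}"
      then show "card S \<le> rk F"
        using rk_eq_card[of S] rk_mono[of S F] FE by simp
    qed
    finally have e: "e = (- 1) ^ rk F * i F"
      unfolding e_def i_def by (simp add: sum_distrib_left)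
    have monom: "monom e (rk F) = of_int e * X ^ rk F"
      unfolding X_def by (simp add: monom_altdef of_int_poly)
    have "h_br (restriction B F) (r F) =
        (\<Sum>S\<in>nbc F (r F). X ^ card S * Y ^ (rk (indices B) - rk F - card S))"
      unfolding X_def Y_def h_br_def bc_complex_restriction[OF FE]
      by (rule h_polynomial_eq) (simp_all add: Max_card_nbc[OF F r'[OF F]])
    then have "h_br (restriction B F) (r F) * monom e (rk F) =
        (\<Sum>S\<in>nbc F (r F). of_int e * P (rk F + card S))"
      unfolding monom P_def by (simp add: sum_distrib_left sum_distrib_right power_add mult_ac)
    also have "\<dots> = (\<Sum>G\<in>flat_sets. \<Sum>S | S \<in> nbc F (r F) \<and> cl (F \<union> S) = G.
        of_int e * P (rk F + card S))"
    proof (rule sum.group[symmetric])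
      show "(\<lambda>S. cl (F \<union> S)) ` nbc F (r F) \<subseteq> flat_sets"
        using FE by (auto simp: nbc_def intro!: cl_in_flat_sets)
    qed simp_all
    also have "\<dots> = (\<Sum>G\<in>flat_sets. \<Sum>S | S \<in> nbc F (r F) \<and> cl (F \<union> S) = G.
        of_int ((- 1) ^ rk G * (i F * (- 1) ^ card S)) * P (rk G))"
    proof (intro sum.cong refl)
      fix G S assume "S \<in> {S. S \<in> nbc F (r F) \<and> cl (F \<union> S) = G}"
      then have S: "S \<in> nbc F (r F)" "cl (F \<union> S) = G" by auto
      then have "F \<union> S \<subseteq> indices B" using FE by (auto simp: nbc_def)
      then have rk: "rk G = rk F + card S"
        using rk_cl[of "F \<union> S"] S(2)
          rk_Un_contraction[OF FE nbc_subset_contraction[OF F r'[OF F] S(1)]] by simp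
      \<comment> \<open>As \<open>rk G = rk F + card S\<close>, the sign for \<open>card S\<close>
        occurs twice and cancels, leaving the sign for \<open>rk F\<close> in
        \<open>e\<close>.\<close>
      have "e = (- 1) ^ rk G * (i F * (- 1) ^ card S)"
        unfolding e rk by (simp add: power_add)
      then show "of_int e * P (rk F + card S) =
          of_int ((- 1) ^ rk G * (i F * (- 1) ^ card S)) * P (rk G)"
        using rk by simp
    qed
    finally show ?thesis
      unfolding flat_rank_eq[OF FE] e_def b_def by (simp add: sum_distrib_left sum_distrib_right)
  qed
  have "(\<Sum>F\<in>flats B. h_br (restriction B F) (r F) *
      monom (coeff (h_arr (localization B F)) (flat_rank B F)) (flat_rank B F)) =
      (\<Sum>F\<in>flat_sets. \<Sum>G\<in>flat_sets. of_int ((- 1) ^ rk G * (i F * b F G)) * P (rk G))"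
    unfolding flats_eq using rhs by (rule sum.cong[OF refl])
  also have "\<dots> = (\<Sum>G\<in>flat_sets. \<Sum>F\<in>flat_sets. of_int ((- 1) ^ rk G * (i F * b F G)) * P (rk G))"
    by (rule sum.swap)
  also have "\<dots> = (\<Sum>G\<in>flat_sets.
      of_int ((- 1) ^ rk G * (\<Sum>F\<in>flat_sets. i F * b F G)) * P (rk G))"
    by (simp add: sum_distrib_left sum_distrib_right)
  also have "\<dots> = h_arr B"
    unfolding lhs i_def b_def using sum_nbc_convolution[OF r'] by (intro sum.cong refl) simp
  finally show ?thesis ..
qed

end

section \<open>Integer normal vectors\<close>

lemma linear_functional_integer_arrangement:
  assumes "a i \<in> carrier_vec d"
  shows "linear_functional d (normal (integer_arrangement d n a) i)"
  using assms
  by (auto simp: linear_functional_def integer_arrangement_def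
    add_scalar_prod_distrib[where n = d] smult_scalar_prod_distrib[where n = d])

theorem corollary5p4:
  fixes d n :: nat
    and a :: "nat \<Rightarrow> int vec"
    and \<sigma> :: "nat set \<Rightarrow> nat rel"
  defines "\<A> \<equiv> integer_arrangement d n a"
  assumes "\<And>i. i \<in> {1..n} \<Longrightarrow> a i \<in> carrier_vec d"
    and "\<And>i. i \<in> {1..n} \<Longrightarrow> a i \<noteq> 0\<^sub>v d"
    and "arr_rank \<A> = d"
    and "\<And>F. F \<in> flats \<A> \<Longrightarrow> linear_order_on ({1..n} - F) (\<sigma> F)"
  shows "h_arr \<A> =
    (\<Sum>F \<in> flats \<A>. h_br (restriction \<A> F) (\<sigma> F) *
       monom (coeff (h_arr (localization \<A> F)) (flat_rank \<A> F)) (flat_rank \<A> F))"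
proof -
  have indices: "indices \<A> = {1..n}" and ambient: "ambient \<A> = carrier_vec d"
    by (simp_all add: \<A>_def integer_arrangement_def)
  interpret vec_arrangement \<A> d
    using linear_functional_integer_arrangement[of a _ d n] assms(2)
    by unfold_locales (auto simp: indices ambient \<A>_def[symmetric])
  show ?thesis
    using assms(5) by (intro h_arr_convolution) (simp add: indices)
qed

end
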